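(* Let $P=([n],\prec)$ be any finite interval order. Let $M_P$ be the $\{0,\pm1\}$-matrix whose $2n$ columns correspond, in this order, to the variables $\ell_1,\dots,\ell_n,\rho_1,\dots,\rho_n$, and whose rows are the coefficient vectors of the left-hand sides of the following inequalities: - $\ell_x+\rho_x-\ell_y\le -1$ for each slack zero cover pair $(x,y)$; - $\ell_x-\ell_y-\rho_y\le 0$ for each slack zero sharp pair $(x,y)$; - $-\rho_x\le 0$ for each $x$ such that $(x,x)$ is a slack zero pair; - $-\ell_x\le 0$ for every $x\in[n]$. Then $M_P$ is totally unimodular.
   Context: A finite partial order $P=([n],\prec)$ is an interval order if there are compact real intervals $I_x=[\ell_x,r_x]$, $x\in[n]$, such that $x\prec y$ if and only if $r_x<\ell_y$. Write $x\parallel y$ if $x\neq y$ and $x,y$ are incomparable. The canonical representation $\mathcal C=[\ell_x,r_x]_{x\in[n]}$ of $P$ is the (unique) interval representation of $P$ using the minimum possible number $m$ of distinct endpoints, with these endpoints placed at the integers $0,1,\dots,m-1$. For $x,y\in[n]$ with $y\not\prec x$, the slack of $(x,y)$ in $\mathcal C$ is $\ell_y-r_x-1$ if $x\prec y$, $r_y-\ell_x$ if $x\parallel y$, and $r_x-\ell_x$ if $x=y$. A pair with slack $0$ is a slack zero pair; it is a slack zero cover pair if $x\prec y$ and a slack zero sharp pair if $x\parallel y$. A matrix is totally unimodular if every square submatrix has determinant $0$, $1$ or $-1$. *)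

theory Defs
  imports
    "HOL.Real"
    "Jordan_Normal_Form.Determinant"
    "Jordan_Normal_Form.DL_Submatrix"
begin

section \<open>Interval orders and canonical representations\<close>

text \<open>The ground set \<open>[n]\<close> is taken to be \<open>{..<n}\<close>, matching the 0-based indexing of
  matrices. The order is a predicate on \<open>nat\<close> of which only the restriction to \<open>{..<n}\<close>
  is ever used.\<close>

definition interval_rep ::
  "nat \<Rightarrow> (nat \<Rightarrow> nat \<Rightarrow> bool) \<Rightarrow> (nat \<Rightarrow> real) \<Rightarrow> (nat \<Rightarrow> real) \<Rightarrow> bool" where
  "interval_rep n prec l r \<longleftrightarrow>
     (\<forall>x<n. l x \<le> r x) \<and> (\<forall>x<n. \<forall>y<n. prec x y \<longleftrightarrow> r x < l y)"

definition interval_order :: "nat \<Rightarrow> (nat \<Rightarrow> nat \<Rightarrow> bool) \<Rightarrow> bool" where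
  "interval_order n prec \<longleftrightarrow>
     irreflp_on {..<n} prec \<and> transp_on {..<n} prec \<and> (\<exists>l r. interval_rep n prec l r)"

definition endpoints :: "nat \<Rightarrow> (nat \<Rightarrow> real) \<Rightarrow> (nat \<Rightarrow> real) \<Rightarrow> real set" where
  "endpoints n l r = l ` {..<n} \<union> r ` {..<n}"

text \<open>The canonical representation is unique only up to the irrelevant values of \<open>l\<close> and
  \<open>r\<close> outside \<open>{..<n}\<close>; it is therefore given by a predicate. Existence is shown
  in \<open>canonical_rep_exists\<close> below.\<close>

definition canonical_rep ::
  "nat \<Rightarrow> (nat \<Rightarrow> nat \<Rightarrow> bool) \<Rightarrow> (nat \<Rightarrow> real) \<Rightarrow> (nat \<Rightarrow> real) \<Rightarrow> bool" where
  "canonical_rep n prec l r \<longleftrightarrow>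
     interval_rep n prec l r \<and>
     (\<forall>l' r'. interval_rep n prec l' r' \<longrightarrow> card (endpoints n l r) \<le> card (endpoints n l' r')) \<and>
     endpoints n l r = real ` {..<card (endpoints n l r)}"

definition parallel :: "(nat \<Rightarrow> nat \<Rightarrow> bool) \<Rightarrow> nat \<Rightarrow> nat \<Rightarrow> bool" where
  "parallel prec x y \<longleftrightarrow> x \<noteq> y \<and> \<not> prec x y \<and> \<not> prec y x"

text \<open>Only meaningful for pairs with \<open>\<not> prec y x\<close>.\<close>

definition slack ::
  "(nat \<Rightarrow> nat \<Rightarrow> bool) \<Rightarrow> (nat \<Rightarrow> real) \<Rightarrow> (nat \<Rightarrow> real) \<Rightarrow> nat \<Rightarrow> nat \<Rightarrow> real" where
  "slack prec l r x y =
     (if prec x y then l y - r x - 1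
      else if parallel prec x y then r y - l x
      else r x - l x)"

definition slack_zero_pair ::
  "(nat \<Rightarrow> nat \<Rightarrow> bool) \<Rightarrow> (nat \<Rightarrow> real) \<Rightarrow> (nat \<Rightarrow> real) \<Rightarrow> nat \<Rightarrow> nat \<Rightarrow> bool" where
  "slack_zero_pair prec l r x y \<longleftrightarrow> \<not> prec y x \<and> slack prec l r x y = 0"

definition slack_zero_cover_pair ::
  "(nat \<Rightarrow> nat \<Rightarrow> bool) \<Rightarrow> (nat \<Rightarrow> real) \<Rightarrow> (nat \<Rightarrow> real) \<Rightarrow> nat \<Rightarrow> nat \<Rightarrow> bool" where
  "slack_zero_cover_pair prec l r x y \<longleftrightarrow> slack_zero_pair prec l r x y \<and> prec x y"

definition slack_zero_sharp_pair ::
  "(nat \<Rightarrow> nat \<Rightarrow> bool) \<Rightarrow> (nat \<Rightarrow> real) \<Rightarrow> (nat \<Rightarrow> real) \<Rightarrow> nat \<Rightarrow> nat \<Rightarrow> bool" where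
  "slack_zero_sharp_pair prec l r x y \<longleftrightarrow> slack_zero_pair prec l r x y \<and> parallel prec x y"

section \<open>The coefficient matrix\<close>

text \<open>Coefficient vectors of the variables \<open>\<ell>\<^sub>x\<close> (columns \<open>0,\<dots>,n-1\<close>) and
  \<open>\<rho>\<^sub>x\<close> (columns \<open>n,\<dots>,2n-1\<close>).\<close>

definition ell :: "nat \<Rightarrow> nat \<Rightarrow> int vec" where
  "ell n x = unit_vec (2 * n) x"

definition rho :: "nat \<Rightarrow> nat \<Rightarrow> int vec" where
  "rho n x = unit_vec (2 * n) (n + x)"

definition coefficient_rows ::
  "nat \<Rightarrow> (nat \<Rightarrow> nat \<Rightarrow> bool) \<Rightarrow> (nat \<Rightarrow> real) \<Rightarrow> (nat \<Rightarrow> real) \<Rightarrow> int vec list" where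
  "coefficient_rows n prec l r =
     [ell n x + rho n x - ell n y. x \<leftarrow> [0..<n], y \<leftarrow> [0..<n], slack_zero_cover_pair prec l r x y] @
     [ell n x - ell n y - rho n y. x \<leftarrow> [0..<n], y \<leftarrow> [0..<n], slack_zero_sharp_pair prec l r x y] @
     [- rho n x. x \<leftarrow> [0..<n], slack_zero_pair prec l r x x] @
     [- ell n x. x \<leftarrow> [0..<n]]"

definition coefficient_matrix ::
  "nat \<Rightarrow> (nat \<Rightarrow> nat \<Rightarrow> bool) \<Rightarrow> (nat \<Rightarrow> real) \<Rightarrow> (nat \<Rightarrow> real) \<Rightarrow> int mat" where
  "coefficient_matrix n prec l r = mat_of_rows (2 * n) (coefficient_rows n prec l r)"

definition totally_unimodular :: "int mat \<Rightarrow> bool" where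
  "totally_unimodular A \<longleftrightarrow>
     (\<forall>I J. I \<subseteq> {..<dim_row A} \<and> J \<subseteq> {..<dim_col A} \<and> card I = card J \<longrightarrow>
        det (submatrix A I J) \<in> {-1, 0, 1})"

section \<open>Existence of canonical representations\<close>

lemma finite_endpoints: "finite (endpoints n l r)"
  by (simp add: endpoints_def)

lemma rank_image:
  fixes E :: "real set"
  assumes "finite E"
  shows "(\<lambda>e. card {a \<in> E. a < e}) ` E = {..<card E}"
    and "\<And>a b. a \<in> E \<Longrightarrow> a < b \<Longrightarrow> card {c \<in> E. c < a} < card {c \<in> E. c < b}"
proof -
  let ?f = "\<lambda>e. card {a \<in> E. a < e}"
  show mono: "?f a < ?f b" if "a \<in> E" "a < b" for a b
    by (rule psubset_card_mono) (use assms that in auto)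
  have inj: "inj_on ?f E"
    by (rule linorder_inj_onI) (use mono in \<open>auto dest: less_imp_neq\<close>)
  have "?f ` E \<subseteq> {..<card E}"
  proof (rule image_subsetI)
    fix e assume "e \<in> E"
    then have "{a \<in> E. a < e} \<subset> E" by auto
    then show "?f e \<in> {..<card E}" using assms psubset_card_mono by blast
  qed
  moreover have "card (?f ` E) = card {..<card E}" using inj card_image by force
  ultimately show "?f ` E = {..<card E}" by (intro card_subset_eq) auto
qed

lemma canonical_rep_exists:
  assumes "interval_order n prec"
  shows "\<exists>l r. canonical_rep n prec l r"
proof -
  define m where "m = (LEAST m. \<exists>l r. interval_rep n prec l r \<and> card (endpoints n l r) = m)"
  have "\<exists>m l r. interval_rep n prec l r \<and> card (endpoints n l r) = m"
    using assms by (auto simp: interval_order_def)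
  then have "\<exists>l r. interval_rep n prec l r \<and> card (endpoints n l r) = m"
    unfolding m_def by (rule LeastI_ex)
  then obtain l r where lr: "interval_rep n prec l r" "card (endpoints n l r) = m"
    by blast
  have least: "m \<le> card (endpoints n l' r')" if "interval_rep n prec l' r'" for l' r'
    unfolding m_def using that by (intro Least_le) blast
  define E where "E = endpoints n l r"
  define f where "f = (\<lambda>e. card {a \<in> E. a < e})"
  have fin: "finite E" by (simp add: E_def finite_endpoints)
  have img: "f ` E = {..<m}" using rank_image(1)[OF fin] lr by (simp add: f_def E_def)
  have less: "f a < f b \<longleftrightarrow> a < b" if "a \<in> E" "b \<in> E" for a b
    using rank_image(2)[OF fin, of a b] rank_image(2)[OF fin, of b a] that
    unfolding f_def by (cases a b rule: linorder_cases) auto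
  have le: "f a \<le> f b \<longleftrightarrow> a \<le> b" if "a \<in> E" "b \<in> E" for a b
    using less[OF that(2,1)] by linarith
  have mem: "l x \<in> E" "r x \<in> E" if "x < n" for x
    using that by (auto simp: E_def endpoints_def)
  let ?l = "\<lambda>x. real (f (l x))" and ?r = "\<lambda>x. real (f (r x))"
  have "interval_rep n prec ?l ?r"
    using lr(1) by (auto simp: interval_rep_def less le mem)
  moreover have ends: "endpoints n ?l ?r = real ` {..<m}"
    unfolding img[symmetric] E_def endpoints_def by (simp only: image_Un image_image)
  moreover have "card (endpoints n ?l ?r) = m"
    by (simp add: ends card_image)
  ultimately have "canonical_rep n prec ?l ?r"
    using least unfolding canonical_rep_def by auto
  then show ?thesis by blast
qed

end

theory Submission
  imports Defs
begin

text \<open>Take the rooted tree in which each \<open>x\<close> contributes a path root -- \<open>L x\<close> -- \<open>R x\<close> whose two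
  edges are the variables \<open>\<ell> x\<close> and \<open>\<rho> x\<close>. Every row of the matrix is then a difference of two
  root-to-node path vectors, so the matrix is a (transposed) network matrix.
  After restricting to a set of columns, that is, contracting the other edges, the matrix factors as
  an incidence matrix times the unitriangular matrix of path vectors.\<close>

section \<open>Determinants of incidence matrices\<close>

text \<open>In \<open>incidence_row A i\<close>, an index \<open>a\<close> or \<open>b\<close> beyond the last column stands for a missing
  entry.\<close>

definition incidence_row :: "int mat \<Rightarrow> nat \<Rightarrow> nat \<Rightarrow> nat \<Rightarrow> bool" where
  "incidence_row A i a b \<longleftrightarrow>
     (\<forall>j<dim_col A. A $$ (i, j) = of_bool (j = a) - of_bool (j = b))"

text \<open>Keeps the row shape available for the induction on minors: an entry in the deleted
  column becomes a missing one.\<close>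

lemma incidence_row_mat_delete:
  assumes A: "A \<in> carrier_mat (Suc k) (Suc k)" and "q < Suc k" "i < k"
    and "\<forall>i<Suc k. \<exists>a b. incidence_row A i a b"
  shows "\<exists>a b. incidence_row (mat_delete A p q) i a b"
proof -
  let ?i = "if i < p then i else Suc i"
  have "?i < Suc k" using assms(3) by simp
  with assms(4) obtain a b where ab: "incidence_row A ?i a b" by blast
  \<comment> \<open>Renumbers columns once \<open>q\<close> is gone. Column \<open>q\<close> itself
    goes to \<open>k\<close>, one past the last column of the minor, and indices that were out of
    range stay so.\<close>
  define f where "f a = (if a = q then k else if a < q then a else a - 1)" for a
  have f: "j = f a \<longleftrightarrow> (if j < q then j else Suc j) = a" if "j < k" for j a
    using that assms(2) by (auto simp: f_def)
  have "incidence_row (mat_delete A p q) i (f a) (f b)"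
    unfolding incidence_row_def
  proof (intro allI impI)
    fix j assume "j < dim_col (mat_delete A p q)"
    then have j: "j < k" using A by simp
    then have "mat_delete A p q $$ (i, j) = A $$ (?i, if j < q then j else Suc j)"
      using A assms(3) by (simp add: mat_delete_def)
    also have "\<dots> = of_bool ((if j < q then j else Suc j) = a)
        - of_bool ((if j < q then j else Suc j) = b)"
      using ab A j unfolding incidence_row_def by simp
    finally show "mat_delete A p q $$ (i, j) = of_bool (j = f a) - of_bool (j = f b)"
      by (simp only: f[OF j])
  qed
  then show ?thesis by blast
qed

text \<open>Induction on the size. If some row has a missing entry, Laplace expansion along it
  leaves at most one cofactor up to sign; otherwise the matrix is singular.\<close>

lemma det_incidence:
  assumes "A \<in> carrier_mat k k"
    and "\<forall>i<k. \<exists>a b. incidence_row A i a b"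
  shows "det A \<in> {-1, 0, 1}"
  using assms
proof (induction k arbitrary: A)
  case 0
  then show ?case by (simp add: det_dim_zero)
next
  case (Suc k)
  let ?k = "Suc k"
  note A = Suc.prems(1)
  have cof: "cofactor A p q \<in> {-1, 0, 1}" if "p < ?k" "q < ?k" for p q
  proof -
    have "det (mat_delete A p q) \<in> {-1, 0, 1}"
      using incidence_row_mat_delete[OF A that(2) _ Suc.prems(2)]
      by (intro Suc.IH) (use mat_delete_carrier[OF A] in auto)
    then show ?thesis
      by (cases "even (p + q)") (auto simp: cofactor_def)
  qed
  show ?case
  proof (cases "\<exists>i<?k. \<exists>a b. incidence_row A i a b \<and> (a \<ge> ?k \<or> b \<ge> ?k)")
    case True
    then obtain i a b where i: "i < ?k" and ab: "incidence_row A i a b"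
      and missing: "a \<ge> ?k \<or> b \<ge> ?k"
      by blast
    have "det A = (\<Sum>j<?k. A $$ (i, j) * cofactor A i j)"
      by (rule laplace_expansion_row[OF A i])
    also have "\<dots> = (\<Sum>j<?k. (if j = a then cofactor A i j else 0)
        - (if j = b then cofactor A i j else 0))"
      using ab A by (intro sum.cong) (auto simp: incidence_row_def)
    also have "\<dots> = (if a < ?k then cofactor A i a else 0) - (if b < ?k then cofactor A i b else 0)"
      by (simp add: sum_subtractf)
    finally show ?thesis
      using cof[OF i, of a] cof[OF i, of b] missing by auto
  next
    case False
    \<comment> \<open>Both indices of every row are now in range, so each row sums to zero and the
      all-ones vector lies in the kernel.\<close>
    let ?v = "vec ?k (\<lambda>_. 1) :: int vec"
    have "A *\<^sub>v ?v = 0\<^sub>v ?k"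
    proof (rule eq_vecI)
      fix i assume "i < dim_vec (0\<^sub>v ?k :: int vec)"
      then have i: "i < ?k" by simp
      then obtain a b where ab: "incidence_row A i a b" "a < ?k" "b < ?k"
        using Suc.prems(2) False by (meson not_le)
      have "(A *\<^sub>v ?v) $ i = (\<Sum>j<?k. of_bool (j = a) - of_bool (j = b))"
        using ab A i by (auto simp: incidence_row_def scalar_prod_def atLeast0LessThan
            simp del: sum.lessThan_Suc intro!: sum.cong)
      also have "\<dots> = 0"
        using ab by (simp add: sum_subtractf of_bool_def del: sum.lessThan_Suc)
      finally show "(A *\<^sub>v ?v) $ i = 0\<^sub>v ?k $ i" using i by simp
    qed (use A in auto)
    moreover have "?v \<noteq> 0\<^sub>v ?k" by (metis index_vec index_zero_vec(1) zero_less_Suc zero_neq_one)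
    ultimately have "det A = 0"
      by (subst det_0_iff_vec_prod_zero[OF A]) (auto intro!: exI[of _ ?v])
    then show ?thesis by simp
  qed
qed

section \<open>Path vectors\<close>

text \<open>Node \<open>L x\<close> is encoded as \<open>x\<close>, node \<open>R x\<close> as \<open>n + x\<close>, the root as \<open>3 * n\<close>; \<open>path_entry n v c\<close>
  is the \<open>c\<close>-th coordinate (\<open>c < 2 * n\<close>) of the path vector from the root to \<open>v\<close>.\<close>

definition path_entry :: "nat \<Rightarrow> nat \<Rightarrow> nat \<Rightarrow> int" where
  "path_entry n v c = of_bool (c = v) + of_bool (c + n = v)"

text \<open>The code \<open>3 * n\<close> gives the root a zero path vector; \<open>2 * n\<close>
  would clash with \<open>c + n\<close> at \<open>c = n\<close>.\<close>

definition tree_nodes :: "nat \<Rightarrow> nat set" where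
  "tree_nodes n = insert (3 * n) {..<2 * n}"

text \<open>Contracting the edges outside \<open>J\<close> identifies every node with the root or with a node whose
  parent edge is in \<open>J\<close>.\<close>

lemma path_entry_restrict:
  assumes "J \<subseteq> {..<2 * n}" "v \<in> tree_nodes n"
  obtains "\<forall>c\<in>J. path_entry n v c = 0"
    | w where "w \<in> J" "\<forall>c\<in>J. path_entry n v c = path_entry n w c"
proof -
  \<comment> \<open>Either the parent edge of \<open>v\<close> survives, or \<open>v\<close> is some
    \<open>R x\<close> merged into \<open>L x\<close>, or its whole path is contracted.\<close>
  consider "v \<in> J" | "v \<notin> J" "v \<ge> n" "v - n \<in> J" "v < 2 * n" | "\<forall>c\<in>J. path_entry n v c = 0"
    using assms by (force simp: path_entry_def tree_nodes_def)
  then show ?thesis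
  proof cases
    case 2
    then have "\<forall>c\<in>J. path_entry n v c = path_entry n (v - n) c"
      by (auto simp: path_entry_def)
    with 2 that show ?thesis by blast
  qed (use that in blast)+
qed

lemma totally_unimodular_path_differences:
  assumes dim: "dim_col A = 2 * n"
    and rows: "\<And>i. i < dim_row A \<Longrightarrow> \<exists>a\<in>tree_nodes n. \<exists>b\<in>tree_nodes n.
      \<forall>c<2 * n. A $$ (i, c) = path_entry n a c - path_entry n b c"
  shows "totally_unimodular A"
  unfolding totally_unimodular_def
proof (intro allI impI, elim conjE)
  fix I J assume I: "I \<subseteq> {..<dim_row A}" and "J \<subseteq> {..<dim_col A}" and card: "card I = card J"
  then have J: "J \<subseteq> {..<2 * n}" by (simp add: dim)
  define k where "k = card J"
  have cards: "card {i. i < dim_row A \<and> i \<in> I} = k" "card {j. j < dim_col A \<and> j \<in> J} = k"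
    using I J card dim by (simp_all add: k_def Collect_conj_eq inf.absorb2 lessThan_def)
  have finJ: "finite J" using J finite_subset by blast
  have pickJ: "pick J j \<in> J" if "j < k" for j
    using that by (auto simp: k_def intro: pick_in_set_le)
  have pickI: "pick I i < dim_row A" if "i < k" for i
    using that I card pick_in_set_le[of i I] by (auto simp: k_def)
  have mono: "pick J i < pick J j" if "i < j" "j < k" for i j
    using that by (auto simp: k_def intro: pick_mono_le)
  have surj: "\<exists>j<k. pick J j = c" if "c \<in> J" for c
  proof -
    have "inj_on (pick J) {..<k}"
      by (rule linorder_inj_onI) (use mono in \<open>auto dest: less_imp_neq\<close>)
    then have "pick J ` {..<k} = J"
      using pickJ finJ by (intro card_subset_eq) (auto simp: card_image k_def)
    with that show ?thesis by (metis imageE lessThan_iff)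
  qed
  \<comment> \<open>Row \<open>i\<close> is the path vector to the lower end of the
    \<open>i\<close>-th edge of \<open>J\<close>, restricted to \<open>J\<close>.\<close>
  define Q where "Q = mat k k (\<lambda>(i, j). path_entry n (pick J i) (pick J j))"
  have Q: "Q \<in> carrier_mat k k" by (simp add: Q_def)
  have detQ: "det Q = 1"
  proof -
    \<comment> \<open>The path vector to \<open>v\<close> is supported on indices at most
      \<open>v\<close>, and \<open>pick J\<close> is increasing.\<close>
    have "det Q = prod_list (diag_mat Q)"
    proof (rule det_lower_triangular[OF _ Q])
      fix i j assume "i < j" "j < k"
      then show "Q $$ (i, j) = 0"
        using mono[of i j] by (auto simp: Q_def path_entry_def)
    qed
    also have "diag_mat Q = replicate k 1"
    proof (rule nth_equalityI)
      fix i assume "i < length (diag_mat Q)"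
      then have "i < k" by (simp add: diag_mat_def Q_def)
      \<comment> \<open>With \<open>n = 0\<close> both indicators in \<open>path_entry\<close> would
        fire on the diagonal, giving 2.\<close>
      moreover from this have "n > 0" using pickJ J by force
      ultimately show "diag_mat Q ! i = replicate k 1 ! i"
        by (simp add: diag_mat_def Q_def path_entry_def)
    qed (simp add: diag_mat_def Q_def)
    finally show ?thesis by simp
  qed
  have node: "\<exists>a. \<forall>j<k. path_entry n v (pick J j) = (\<Sum>i<k. of_bool (i = a) * Q $$ (i, j))"
    if "v \<in> tree_nodes n" for v
    using J that
  proof (cases rule: path_entry_restrict)
    case 1
    \<comment> \<open>The index \<open>k\<close> selects no row of \<open>Q\<close>: the node is
      contracted to the root.\<close>
    then show ?thesis using pickJ by (intro exI[of _ k]) auto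
  next
    case (2 w)
    then obtain a where a: "a < k" "pick J a = w" using surj by blast
    then have "(\<Sum>i<k. of_bool (i = a) * Q $$ (i, j)) = Q $$ (a, j)" for j
      by (simp add: of_bool_def if_distrib[of "\<lambda>x. x * _"] cong: if_cong)
    then show ?thesis using 2 a pickJ by (intro exI[of _ a]) (auto simp: Q_def)
  qed
  have row: "\<exists>a b. \<forall>j<k. A $$ (pick I i, pick J j)
      = (\<Sum>t<k. (of_bool (t = a) - of_bool (t = b)) * Q $$ (t, j))" if i: "i < k" for i
  proof -
    from rows[OF pickI[OF i]] obtain u v where uv: "u \<in> tree_nodes n" "v \<in> tree_nodes n"
      and eq: "\<forall>c<2 * n. A $$ (pick I i, c) = path_entry n u c - path_entry n v c"
      by blast
    obtain a b where
      "\<forall>j<k. path_entry n u (pick J j) = (\<Sum>t<k. of_bool (t = a) * Q $$ (t, j))"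
      "\<forall>j<k. path_entry n v (pick J j) = (\<Sum>t<k. of_bool (t = b) * Q $$ (t, j))"
      using node[OF uv(1)] node[OF uv(2)] by blast
    moreover have "pick J j < 2 * n" if "j < k" for j using pickJ[OF that] J by auto
    ultimately show ?thesis using eq
      by (intro exI[of _ a] exI[of _ b])
        (simp add: left_diff_distrib sum_subtractf del: sum_mult_of_bool_eq sum_of_bool_mult_eq)
  qed
  have "\<forall>i. \<exists>a b. i < k \<longrightarrow> (\<forall>j<k. A $$ (pick I i, pick J j)
      = (\<Sum>t<k. (of_bool (t = a) - of_bool (t = b)) * Q $$ (t, j)))"
    using row by blast
  from choice[OF this] obtain a where "\<forall>i. \<exists>b. i < k \<longrightarrow> (\<forall>j<k. A $$ (pick I i, pick J j)
      = (\<Sum>t<k. (of_bool (t = a i) - of_bool (t = b)) * Q $$ (t, j)))" ..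
  from choice[OF this] obtain b where ab: "\<forall>i. i < k \<longrightarrow> (\<forall>j<k. A $$ (pick I i, pick J j)
      = (\<Sum>t<k. (of_bool (t = a i) - of_bool (t = b i)) * Q $$ (t, j)))" ..
  define N :: "int mat" where "N = mat k k (\<lambda>(i, t). of_bool (t = a i) - of_bool (t = b i))"
  have N: "N \<in> carrier_mat k k" by (simp add: N_def)
  have "submatrix A I J = N * Q"
  proof (rule eq_matI)
    fix i j assume "i < dim_row (N * Q)" "j < dim_col (N * Q)"
    then have ij: "i < k" "j < k" using N Q by auto
    then have "submatrix A I J $$ (i, j) = A $$ (pick I i, pick J j)"
      using cards by (intro submatrix_index) auto
    also have "\<dots> = (N * Q) $$ (i, j)"
      using ij N Q by (simp add: ab scalar_prod_def atLeast0LessThan) (simp add: N_def)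
    finally show "submatrix A I J $$ (i, j) = (N * Q) $$ (i, j)" .
  qed (use cards N Q in \<open>auto simp: dim_submatrix\<close>)
  then have "det (submatrix A I J) = det N"
    using det_mult[OF N Q] detQ by simp
  moreover have "\<forall>i<k. \<exists>a b. incidence_row N i a b"
    unfolding incidence_row_def
    by (intro allI impI, rule_tac x = "a i" in exI, rule_tac x = "b i" in exI) (simp add: N_def)
  ultimately show "det (submatrix A I J) \<in> {-1, 0, 1}"
    using det_incidence[OF N] by simp
qed

text \<open>The path vectors of \<open>L x\<close> and \<open>R x\<close> are \<open>ell n x\<close>
  and \<open>ell n x + rho n x\<close>. So the four kinds of rows are \<open>R x\<close> minus
  \<open>L y\<close>, \<open>L x\<close> minus \<open>R y\<close>, \<open>L x\<close> minus
  \<open>R x\<close>, and root minus \<open>L x\<close>.\<close>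

lemma coefficient_rows_path_differences:
  assumes "v \<in> set (coefficient_rows n prec l r)"
  shows "\<exists>a\<in>tree_nodes n. \<exists>b\<in>tree_nodes n.
    \<forall>c<2 * n. v $ c = path_entry n a c - path_entry n b c"
proof -
  consider x y where "x < n" "y < n" "v = ell n x + rho n x - ell n y"
    | x y where "x < n" "y < n" "v = ell n x - ell n y - rho n y"
    | x where "x < n" "v = - rho n x"
    | x where "x < n" "v = - ell n x"
    using assms by (auto simp: coefficient_rows_def split: if_splits)
  then show ?thesis
  proof cases
    case (1 x y)
    then show ?thesis
      by (intro bexI[of _ "n + x"] bexI[of _ y])
        (auto simp: ell_def rho_def path_entry_def tree_nodes_def)
  next
    case (2 x y)
    then show ?thesis
      by (intro bexI[of _ x] bexI[of _ "n + y"])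
        (auto simp: ell_def rho_def path_entry_def tree_nodes_def)
  next
    case (3 x)
    then show ?thesis
      by (intro bexI[of _ x] bexI[of _ "n + x"])
        (auto simp: rho_def path_entry_def tree_nodes_def)
  next
    case (4 x)
    then show ?thesis
      by (intro bexI[of _ "3 * n"] bexI[of _ x])
        (auto simp: ell_def path_entry_def tree_nodes_def)
  qed
qed

theorem theorem3p1:
  fixes n :: nat
    and prec :: "nat \<Rightarrow> nat \<Rightarrow> bool"
    and l r :: "nat \<Rightarrow> real"
  assumes "interval_order n prec"
    and "canonical_rep n prec l r"
  shows "totally_unimodular (coefficient_matrix n prec l r)"
proof (rule totally_unimodular_path_differences)
  let ?R = "coefficient_rows n prec l r"
  show "dim_col (coefficient_matrix n prec l r) = 2 * n"
    by (simp add: coefficient_matrix_def)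
  fix i assume "i < dim_row (coefficient_matrix n prec l r)"
  then have "i < length ?R" by (simp add: coefficient_matrix_def)
  with coefficient_rows_path_differences[of "?R ! i" n prec l r]
  show "\<exists>a\<in>tree_nodes n. \<exists>b\<in>tree_nodes n. \<forall>c<2 * n.
      coefficient_matrix n prec l r $$ (i, c) = path_entry n a c - path_entry n b c"
    by (simp add: coefficient_matrix_def mat_of_rows_def)
qed

end
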